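(* Let $d\ge 2$ be an integer and let $G$ be a connected $d$-regular bipartite graph. Then $$\gamma_d^{\mathrm L}(G\square K_2)=2\,\gamma(G).$$
   Context: All graphs are finite and simple; $N_G(u)$ is the open neighborhood of $u$ in $G$, and $K_2$ is the complete graph on two vertices. A set $D\subseteq V(G)$ is a dominating set if every vertex of $V(G)\setminus D$ has a neighbor in $D$; $\gamma(G)$ is the minimum cardinality of a dominating set of $G$. For an integer $k\ge 0$, a dominating set $D$ of $G$ is a $k$-limited dominating set if $|N_G(u)\setminus D|\le k$ for every $u\in D$. The $k$-limited domination number $\gamma_k^{\mathrm L}(G)$ is the minimum cardinality of a $k$-limited dominating set of $G$. The Cartesian product $G\square H$ has vertex set $V(G)\times V(H)$, with $(g,h)$ and $(g',h')$ adjacent if and only if either $g=g'$ and $hh'\in E(H)$, or $h=h'$ and $gg'\in E(G)$. *)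

theory Defs
  imports "Graph_Theory.Graph_Theory"
begin

text \<open>
  A finite simple graph is a symmetric, loop-free, finite digraph whose arcs are pairs of
  vertices (locale \<^locale>\<open>pair_graph\<close>); an edge \<open>uv\<close> is the pair of arcs
  \<open>(u, v)\<close>, \<open>(v, u)\<close>.
\<close>

definition nbhd :: "'a pair_pre_digraph \<Rightarrow> 'a \<Rightarrow> 'a set" where
  "nbhd G u = {v. (u, v) \<in> parcs G}"

definition regular :: "nat \<Rightarrow> 'a pair_pre_digraph \<Rightarrow> bool" where
  "regular d G \<longleftrightarrow> (\<forall>v \<in> pverts G. card (nbhd G v) = d)"

definition bipartite :: "'a pair_pre_digraph \<Rightarrow> bool" where
  "bipartite G \<longleftrightarrow> (\<exists>A B. pverts G = A \<union> B \<and> A \<inter> B = {} \<and> parcs G \<subseteq> A \<times> B \<union> B \<times> A)"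

definition dominating_set :: "'a pair_pre_digraph \<Rightarrow> 'a set \<Rightarrow> bool" where
  "dominating_set G D \<longleftrightarrow>
     D \<subseteq> pverts G \<and> (\<forall>v \<in> pverts G - D. \<exists>u \<in> D. u \<in> nbhd G v)"

definition limited_dominating_set :: "nat \<Rightarrow> 'a pair_pre_digraph \<Rightarrow> 'a set \<Rightarrow> bool" where
  "limited_dominating_set k G D \<longleftrightarrow>
     dominating_set G D \<and> (\<forall>u \<in> D. card (nbhd G u - D) \<le> k)"

text \<open>In a finite graph the full vertex set satisfies both properties, so both minima exist.\<close>

definition domination_number :: "'a pair_pre_digraph \<Rightarrow> nat" where
  "domination_number G = (LEAST n. \<exists>D. dominating_set G D \<and> card D = n)"

definition limited_domination_number :: "nat \<Rightarrow> 'a pair_pre_digraph \<Rightarrow> nat" where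
  "limited_domination_number k G = (LEAST n. \<exists>D. limited_dominating_set k G D \<and> card D = n)"

definition cartesian_product ::
  "'a pair_pre_digraph \<Rightarrow> 'b pair_pre_digraph \<Rightarrow> ('a \<times> 'b) pair_pre_digraph"
  (infixl \<open>\<box>\<close> 70) where
  "G \<box> H = \<lparr> pverts = pverts G \<times> pverts H,
     parcs = {((g, h), (g', h')).
       (g = g' \<and> g \<in> pverts G \<and> (h, h') \<in> parcs H) \<or>
       (h = h' \<and> h \<in> pverts H \<and> (g, g') \<in> parcs G)} \<rparr>"

lemma pair_graph_cartesian_product:
  assumes "pair_graph G" "pair_graph H"
  shows "pair_graph (G \<box> H)"
proof -
  interpret G: pair_graph G by fact
  interpret H: pair_graph H by fact
  have sG: "sym (parcs G)" and sH: "sym (parcs H)"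
    using G.pair_sym_arcs H.pair_sym_arcs by (simp_all add: symmetric_def)
  have sub: "parcs (G \<box> H) \<subseteq> (pverts G \<times> pverts H) \<times> (pverts G \<times> pverts H)"
    by (auto simp: cartesian_product_def dest: G.in_arcsD1 G.in_arcsD2 H.in_arcsD1 H.in_arcsD2)
  show ?thesis
  proof
    show "finite (parcs (G \<box> H))"
      using finite_subset[OF sub] by simp
    show "symmetric (with_proj (G \<box> H))"
      using sG sH by (auto simp: symmetric_def cartesian_product_def sym_def)
  qed (auto simp: cartesian_product_def dest: G.pair_no_loops H.pair_no_loops
      G.in_arcsD1 G.in_arcsD2 H.in_arcsD1 H.in_arcsD2)
qed

end

theory Submission
  imports Defs
begin

text \<open>
  The product \<open>G \<box> K\<^sub>2\<close> is \<open>(d + 1)\<close>-regular, so the \<open>d\<close>-limited condition says that every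
  vertex of the dominating set has a neighbour in it: the \<open>d\<close>-limited dominating sets are exactly
  the total dominating sets. If \<open>D\<close> dominates \<open>G\<close>, then \<open>D \<times> V(K\<^sub>2)\<close> is such a set. Conversely,
  let \<open>S\<close> be one and \<open>A\<close>, \<open>B\<close> the colour classes of \<open>G\<close>. The trace of \<open>S\<close> on \<open>A\<close> in one layer
  together with its trace on \<open>B\<close> in the other layer dominates \<open>G\<close>, because a neighbour of a vertex
  in the product changes either the layer or the colour class. Exchanging the layers gives two
  dominating sets of \<open>G\<close> that partition \<open>S\<close>.
\<close>

definition total_dominating_set :: "'a pair_pre_digraph \<Rightarrow> 'a set \<Rightarrow> bool" where
  "total_dominating_set G D \<longleftrightarrow> D \<subseteq> pverts G \<and> (\<forall>v \<in> pverts G. \<exists>u \<in> D. u \<in> nbhd G v)"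

lemma finite_nbhd:
  assumes "pair_graph G"
  shows "finite (nbhd G v)"
proof -
  interpret pair_graph G by fact
  have "nbhd G v \<subseteq> pverts G"
    by (auto simp: nbhd_def dest: in_arcsD2)
  then show ?thesis
    by (rule finite_subset) simp
qed

text \<open>With \<open>Suc k\<close> neighbours, at most \<open>k\<close> of them lie outside
  \<open>D\<close> exactly when at least one lies in \<open>D\<close>. So the limit supplies
  neighbours in \<open>D\<close> for the vertices of \<open>D\<close>, and domination supplies them
  for all others.\<close>

lemma limited_iff_total_dominating_set:
  assumes "pair_graph G" "regular (Suc k) G"
  shows "limited_dominating_set k G D \<longleftrightarrow> total_dominating_set G D"
proof -
  have *: "card (nbhd G v - D) \<le> k \<longleftrightarrow> nbhd G v \<inter> D \<noteq> {}" if "v \<in> pverts G" for v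
  proof -
    have fin: "finite (nbhd G v)" and card: "card (nbhd G v) = Suc k"
      using assms that by (auto simp: finite_nbhd regular_def)
    show ?thesis
    proof
      assume "card (nbhd G v - D) \<le> k"
      then show "nbhd G v \<inter> D \<noteq> {}"
        using card by (auto simp: Diff_triv)
    next
      assume "nbhd G v \<inter> D \<noteq> {}"
      then have "nbhd G v - D \<subset> nbhd G v"
        by auto
      then show "card (nbhd G v - D) \<le> k"
        using psubset_card_mono[OF fin, of "nbhd G v - D"] card by simp
    qed
  qed
  show ?thesis
  proof
    assume "limited_dominating_set k G D"
    then have dom: "dominating_set G D" and lim: "\<forall>v \<in> D. card (nbhd G v - D) \<le> k"
      and sub: "D \<subseteq> pverts G"
      by (auto simp: limited_dominating_set_def dominating_set_def)
    have "\<exists>u \<in> D. u \<in> nbhd G v" if "v \<in> pverts G" for v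
    proof (cases "v \<in> D")
      case True
      then show ?thesis
        using lim *[OF that] by blast
    next
      case False
      then show ?thesis
        using dom that by (simp add: dominating_set_def)
    qed
    then show "total_dominating_set G D"
      using sub by (simp add: total_dominating_set_def)
  next
    assume "total_dominating_set G D"
    then have sub: "D \<subseteq> pverts G" and nb: "\<forall>v \<in> pverts G. \<exists>u \<in> D. u \<in> nbhd G v"
      by (auto simp: total_dominating_set_def)
    then have "card (nbhd G v - D) \<le> k" if "v \<in> D" for v
      using that * by blast
    then show "limited_dominating_set k G D"
      using sub nb by (simp add: limited_dominating_set_def dominating_set_def)
  qed
qed

lemma pverts_cartesian_product [simp]: "pverts (G \<box> H) = pverts G \<times> pverts H"
  by (simp add: cartesian_product_def)

lemma nbhd_cartesian_product:
  assumes "g \<in> pverts G" "h \<in> pverts H"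
  shows "nbhd (G \<box> H) (g, h) = nbhd G g \<times> {h} \<union> {g} \<times> nbhd H h"
  using assms by (auto simp: nbhd_def cartesian_product_def)

lemma regular_cartesian_product:
  assumes "pair_graph G" "pair_graph H" "regular d G" "regular e H"
  shows "regular (d + e) (G \<box> H)"
proof -
  interpret G: pair_graph G by fact
  have "card (nbhd (G \<box> H) (g, h)) = d + e" if "g \<in> pverts G" "h \<in> pverts H" for g h
  proof -
    \<comment> \<open>A common element could only be \<open>(g, h)\<close> itself, which would give
      a loop at \<open>g\<close>.\<close>
    have "nbhd G g \<times> {h} \<inter> {g} \<times> nbhd H h = {}"
      by (auto simp: nbhd_def dest: G.pair_no_loops)
    then show ?thesis
      using assms that
      by (simp add: nbhd_cartesian_product card_Un_disjoint finite_nbhd card_cartesian_product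
          regular_def)
  qed
  then show ?thesis
    by (auto simp: regular_def)
qed

lemma complete_digraph_2E:
  assumes "complete_digraph 2 (with_proj K)"
  obtains a b where "a \<noteq> b" "pverts K = {a, b}" "nbhd K a = {b}" "nbhd K b = {a}"
    "pair_graph K"
proof -
  have card: "card (pverts K) = 2"
    and arcs: "parcs K = {(u, v). u \<in> pverts K \<and> v \<in> pverts K \<and> u \<noteq> v}"
    using assms by (auto simp: complete_digraph_pair_def)
  obtain a b where verts: "pverts K = {a, b}" and "a \<noteq> b"
    using card by (auto simp: card_2_iff)
  have arcs': "parcs K = {(a, b), (b, a)}"
    using verts \<open>a \<noteq> b\<close> arcs by auto
  have "pair_graph K"
  proof
    have "sym (parcs K)"
      by (auto simp: arcs' sym_def)
    then show "symmetric (with_proj K)"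
      by (simp add: symmetric_def)
  qed (use \<open>a \<noteq> b\<close> in \<open>auto simp: verts arcs'\<close>)
  moreover have "nbhd K a = {b}" "nbhd K b = {a}"
    using arcs' \<open>a \<noteq> b\<close> by (auto simp: nbhd_def)
  ultimately show ?thesis
    using that \<open>a \<noteq> b\<close> verts by blast
qed

lemma domination_number_le: "dominating_set G D \<Longrightarrow> domination_number G \<le> card D"
  unfolding domination_number_def by (rule Least_le) auto

lemma domination_number_attained:
  obtains D where "dominating_set G D" "card D = domination_number G"
proof -
  have "dominating_set G (pverts G)"
    by (simp add: dominating_set_def)
  then have "\<exists>n D. dominating_set G D \<and> card D = n"
    by blast
  from LeastI_ex[OF this] show ?thesis
    using that unfolding domination_number_def by blast
qed

lemma dominating_set_crossed_layers:
  assumes S: "total_dominating_set (G \<box> K) S"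
    and K: "pverts K = {a, b}" "nbhd K a = {b}" "nbhd K b = {a}"
    and verts: "pverts G = A \<union> B" and arcs: "parcs G \<subseteq> A \<times> B \<union> B \<times> A" and "A \<inter> B = {}"
  shows "dominating_set G {g. g \<in> A \<and> (g, a) \<in> S \<or> g \<in> B \<and> (g, b) \<in> S}"
    (is "dominating_set G ?D")
  unfolding dominating_set_def
proof (intro conjI ballI)
  show "?D \<subseteq> pverts G"
    using verts by auto
next
  fix v
  assume v: "v \<in> pverts G - ?D"
  then consider "v \<in> A" "(v, a) \<notin> S" | "v \<in> B" "(v, b) \<notin> S"
    using verts by auto
  then show "\<exists>u \<in> ?D. u \<in> nbhd G v"
  proof cases
    case 1
    \<comment> \<open>Totality is applied to the copy of \<open>v\<close> in the opposite layer. Its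
      neighbour across the layers is \<open>(v, a)\<close>, which is not in \<open>S\<close>, so the
      neighbour in \<open>S\<close> stays in layer \<open>b\<close>; its first component lies in
      \<open>B\<close> by bipartiteness, hence in the trace.\<close>
    obtain u where "u \<in> S" "u \<in> nbhd (G \<box> K) (v, b)"
      using S v K by (auto simp: total_dominating_set_def)
    then have "u \<in> nbhd G v \<times> {b}"
      using 1 v K by (auto simp: nbhd_cartesian_product)
    then show ?thesis
      using 1 \<open>u \<in> S\<close> arcs \<open>A \<inter> B = {}\<close> by (auto simp: nbhd_def)
  next
    case 2
    obtain u where "u \<in> S" "u \<in> nbhd (G \<box> K) (v, a)"
      using S v K by (auto simp: total_dominating_set_def)
    then have "u \<in> nbhd G v \<times> {a}"
      using 2 v K by (auto simp: nbhd_cartesian_product)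
    then show ?thesis
      using 2 \<open>u \<in> S\<close> arcs \<open>A \<inter> B = {}\<close> by (auto simp: nbhd_def)
  qed
qed

theorem corollary18:
  fixes G :: "'a pair_pre_digraph" and K2 :: "'b pair_pre_digraph" and d :: nat
  assumes "d \<ge> 2"
    and "pair_graph G"
    and "connected (with_proj G)"
    and "regular d G"
    and "bipartite G"
    and "complete_digraph 2 (with_proj K2)"
  shows "limited_domination_number d (G \<box> K2) = 2 * domination_number G"
proof -
  interpret G: pair_graph G by fact
  obtain a b where "a \<noteq> b" and K: "pverts K2 = {a, b}" "nbhd K2 a = {b}" "nbhd K2 b = {a}"
    and "pair_graph K2"
    using complete_digraph_2E[OF assms(6)] .
  have "regular 1 K2"
    using K by (simp add: regular_def)
  then have "regular (Suc d) (G \<box> K2)"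
    using regular_cartesian_product[of G K2 d 1] assms \<open>pair_graph K2\<close> by simp
  then have limited_iff: "limited_dominating_set d (G \<box> K2) S \<longleftrightarrow> total_dominating_set (G \<box> K2) S"
    for S
    using assms \<open>pair_graph K2\<close>
    by (simp add: limited_iff_total_dominating_set pair_graph_cartesian_product)
  show ?thesis
    unfolding limited_domination_number_def limited_iff
  proof (rule Least_equality)
    obtain D where D: "dominating_set G D" "card D = domination_number G"
      by (rule domination_number_attained)
    have "\<exists>u \<in> D \<times> {a, b}. u \<in> nbhd (G \<box> K2) (g, h)"
      if gh: "g \<in> pverts G" "h \<in> pverts K2" for g h
    \<comment> \<open>For \<open>g\<close> in \<open>D\<close> the neighbour is the copy of
      \<open>g\<close> in the other layer; otherwise a neighbour of \<open>g\<close> in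
      \<open>D\<close> is used within layer \<open>h\<close>.\<close>
    proof (cases "g \<in> D")
      case True
      then show ?thesis
        using gh K by (auto simp: nbhd_cartesian_product)
    next
      case False
      then obtain u where "u \<in> D" "u \<in> nbhd G g"
        using D gh by (auto simp: dominating_set_def)
      then show ?thesis
        using gh K by (auto simp: nbhd_cartesian_product)
    qed
    moreover have "D \<times> {a, b} \<subseteq> pverts (G \<box> K2)"
      using D K by (auto simp: dominating_set_def)
    ultimately have "total_dominating_set (G \<box> K2) (D \<times> {a, b})"
      by (auto simp: total_dominating_set_def)
    moreover have "card (D \<times> {a, b}) = 2 * domination_number G"
      using D \<open>a \<noteq> b\<close> by (simp add: card_cartesian_product)
    ultimately show "\<exists>S. total_dominating_set (G \<box> K2) S \<and> card S = 2 * domination_number G"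
      by blast
  next
    fix n
    assume "\<exists>S. total_dominating_set (G \<box> K2) S \<and> card S = n"
    then obtain S where S: "total_dominating_set (G \<box> K2) S" and n: "card S = n"
      by blast
    obtain A B where AB: "pverts G = A \<union> B" "A \<inter> B = {}" "parcs G \<subseteq> A \<times> B \<union> B \<times> A"
      using assms by (auto simp: bipartite_def)
    \<comment> \<open>\<open>x\<close> is the layer read on \<open>A\<close> and \<open>y\<close>
      the layer read on \<open>B\<close>; the two crossed choices are \<open>D a b\<close> and
      \<open>D b a\<close>.\<close>
    define D where "D x y = {g. g \<in> A \<and> (g, x) \<in> S \<or> g \<in> B \<and> (g, y) \<in> S}" for x y
    have sub: "S \<subseteq> (A \<union> B) \<times> {a, b}"
      using S K AB by (auto simp: total_dominating_set_def)
    have dom: "domination_number G \<le> card (D a b)" "domination_number G \<le> card (D b a)"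
      unfolding D_def
      using S K AB by (auto intro!: domination_number_le dominating_set_crossed_layers)
    have "finite (A \<union> B)"
      using AB G.pair_finite_verts by simp
    then have fin: "finite (D x y)" for x y
      by (rule rev_finite_subset) (auto simp: D_def)
    \<comment> \<open>\<open>f x y\<close> lifts \<open>D x y\<close> back into \<open>S\<close>. It
      is injective since it keeps the first component, and \<open>f a b\<close> and
      \<open>f b a\<close> always choose opposite layers, so their images are disjoint.\<close>
    define f where "f x y g = (g, if g \<in> A then x else y)" for x y :: 'b and g :: 'a
    have "S = f a b ` D a b \<union> f b a ` D b a"
      using sub AB by (auto simp: D_def f_def image_iff split: if_splits)
    moreover have "f a b ` D a b \<inter> f b a ` D b a = {}"
      using \<open>a \<noteq> b\<close> by (auto simp: f_def split: if_splits)
    moreover have "inj_on (f x y) (D x' y')" for x y x' y'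
      by (auto simp: f_def inj_on_def)
    ultimately have "card S = card (D a b) + card (D b a)"
      using fin by (simp add: card_Un_disjoint card_image)
    then show "2 * domination_number G \<le> n"
      using dom n by simp
  qed
qed

end
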